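(* Let $\kappa > 0$, $\sigma > 0$ and let $\alpha \in (0,1)$ be such that $$\frac{\sigma^2}{4\kappa^2}\log\left(\frac{1}{\alpha}\right) \ge 3, \qquad \alpha + 2\alpha^{1/4} < 1/2 \qquad \text{and} \qquad \alpha^{5/4}\log(1/\alpha) \le 2\kappa^2\sigma^{-2}.$$ Then, for any change point time $\Delta$ (a positive integer), $$\inf_{\widehat{t} \in \mathcal{D}(\alpha)} \ \sup_{P_{\kappa,\sigma,\Delta}} \mathbb{E}_P\left\{(\widehat{t} - \Delta)_+\right\} \ge \frac{\sigma^2}{4\kappa^2}\log\left(\frac{1}{\alpha}\right),$$ where the supremum is over all joint distributions $P = P_{\kappa,\sigma,\Delta}$ of sequences $\{X_i\}_{i=1,2,\ldots}$ of independent Gaussian random variables with $\mathbb{E}(X_i) = f_i$, $\mathrm{Var}(X_i) = \sigma^2$, $f_1 = \cdots = f_\Delta \ne f_{\Delta+1} = f_{\Delta+2} = \cdots$ and $|f_\Delta - f_{\Delta+1}| = \kappa$, and $$\mathcal{D}(\alpha) = \left\{T : T \text{ is a stopping time with respect to the natural filtration and satisfies } \mathbb{P}_\infty(T < \infty) \le \alpha\right\}.$$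
   Context: Stopping times are with respect to the natural filtration generated by $\{X_i\}_{i=1,2,\ldots}$ and take values in $\mathbb{N} \cup \{\infty\}$. $\mathbb{P}_\infty$ denotes probability under any distribution with no change point, i.e. $\{X_i\}$ independent Gaussian with variance $\sigma^2$ and a constant mean. $(x)_+ = \max\{x, 0\}$, and $\mathbb{E}_P$ is expectation under $P$ (possibly $+\infty$). *)

theory Defs
  imports "HOL-Probability.Probability"
begin

text \<open>
  Observation sequences are indexed by the positive integers, and \<open>X\<^sub>i\<close> is the coordinate map
  \<open>\<lambda>\<omega>. \<omega> i\<close> on the canonical sequence space. A joint distribution of the sequence is a
  probability measure on this space, and a stopping time is a functional of the observed
  sequence, so that the same procedure can be evaluated under every distribution.
\<close>

definition seq_space :: "(nat \<Rightarrow> real) measure" where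
  "seq_space = (\<Pi>\<^sub>M i\<in>{1..}. borel)"

text \<open>
  Time is of type \<^typ>\<open>enat\<close> because stopping times may be infinite. At time \<open>0\<close> the
  \<open>\<sigma>\<close>-algebra is trivial, at time \<open>\<infinity>\<close> it is generated by the whole sequence.
\<close>

definition natural_filtration :: "enat \<Rightarrow> (nat \<Rightarrow> real) measure" where
  "natural_filtration t =
     sigma (space seq_space)
       {{\<omega> \<in> space seq_space. \<omega> i \<in> A} |i A. 1 \<le> i \<and> enat i \<le> t \<and> A \<in> sets borel}"

definition gaussian_laws :: "(nat \<Rightarrow> real) \<Rightarrow> real \<Rightarrow> (nat \<Rightarrow> real) measure set" where
  "gaussian_laws f \<sigma> =
     {P. prob_space P \<and> sets P = sets seq_space \<and>
         prob_space.indep_vars P (\<lambda>_. borel) (\<lambda>i \<omega>. \<omega> i) {1..} \<and>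
         (\<forall>i\<ge>1. distributed P lborel (\<lambda>\<omega>. \<omega> i) (normal_density (f i) \<sigma>))}"

definition no_change_laws :: "real \<Rightarrow> (nat \<Rightarrow> real) measure set" where
  "no_change_laws \<sigma> = (\<Union>\<mu>. gaussian_laws (\<lambda>_. \<mu>) \<sigma>)"

definition change_laws :: "real \<Rightarrow> real \<Rightarrow> nat \<Rightarrow> (nat \<Rightarrow> real) measure set" where
  "change_laws \<kappa> \<sigma> \<Delta> =
     (\<Union>f \<in> {f. (\<forall>i\<in>{1..\<Delta>}. f i = f \<Delta>) \<and> (\<forall>i\<ge>\<Delta> + 1. f i = f (\<Delta> + 1)) \<and>
               f \<Delta> \<noteq> f (\<Delta> + 1) \<and> \<bar>f \<Delta> - f (\<Delta> + 1)\<bar> = \<kappa>}.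
        gaussian_laws f \<sigma>)"

text \<open>The probability of a false alarm is controlled for every value of the constant mean.\<close>

definition detection_procedures :: "real \<Rightarrow> real \<Rightarrow> ((nat \<Rightarrow> real) \<Rightarrow> enat) set" where
  "detection_procedures \<sigma> \<alpha> =
     {T. stopping_time natural_filtration T \<and>
         (\<forall>P \<in> no_change_laws \<sigma>. \<P>(\<omega> in P. T \<omega> < \<infinity>) \<le> \<alpha>)}"

text \<open>
  Subtraction on \<^typ>\<open>enat\<close> is truncated at \<open>0\<close> and satisfies \<open>\<infinity> - enat \<Delta> = \<infinity>\<close>, so the
  integrand is the positive part of \<open>T - \<Delta>\<close>.
\<close>

definition expected_delay ::
    "(nat \<Rightarrow> real) measure \<Rightarrow> nat \<Rightarrow> ((nat \<Rightarrow> real) \<Rightarrow> enat) \<Rightarrow> ennreal" where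
  "expected_delay P \<Delta> T = (\<integral>\<^sup>+\<omega>. ennreal_of_enat (T \<omega> - enat \<Delta>) \<partial>P)"

end

theory Submission
  imports Defs
begin

text \<open>
  Compare the law \<open>P\<^sub>0\<close> with constant mean \<open>0\<close> and the law \<open>P\<^sub>1\<close> whose mean jumps to \<open>\<kappa>\<close> after
  time \<open>\<Delta>\<close>. Let \<open>n\<close> be the largest integer with \<open>n \<le> \<sigma>\<^sup>2 / (2 \<kappa>\<^sup>2) * ln (1 / \<alpha>)\<close>. On the
  \<open>\<sigma>\<close>-algebra of time \<open>\<Delta> + n\<close> the likelihood ratio of \<open>P\<^sub>1\<close> to \<open>P\<^sub>0\<close> has second moment
  \<open>exp (n \<kappa>\<^sup>2 / \<sigma>\<^sup>2) \<le> \<alpha> powr (- 1 / 2)\<close> under \<open>P\<^sub>0\<close>. By the Cauchy--Schwarz inequality, a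
  procedure whose false alarm probability is at most \<open>\<alpha>\<close> satisfies
  \<open>P\<^sub>1 (T \<le> \<Delta> + n)\<^sup>2 \<le> \<alpha> powr (- 1 / 2) * \<alpha>\<close>, that is,
  \<open>P\<^sub>1 (T \<le> \<Delta> + n) \<le> \<alpha> powr (1 / 4) \<le> 1 / 2\<close>. Hence the delay is at least \<open>n + 1\<close> with
  \<open>P\<^sub>1\<close>-probability at least \<open>1 / 2\<close>.
\<close>

section \<open>Likelihood ratios of product measures\<close>

text \<open>By Tonelli the integral of the product of densities over a box factors into coordinate
  integrals, so both measures agree on boxes. Assumption \<open>N\<close> supplies the uniqueness of
  the product measure with these values.\<close>

lemma PiM_density:
  assumes "finite I"
    and M: "product_sigma_finite M"
    and N: "product_sigma_finite (\<lambda>i. density (M i) (g i))"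
    and g: "\<And>i. i \<in> I \<Longrightarrow> g i \<in> borel_measurable (M i)"
  shows "PiM I (\<lambda>i. density (M i) (g i)) = density (PiM I M) (\<lambda>x. \<Prod>i\<in>I. g i (x i))"
proof -
  interpret M: product_sigma_finite M by fact
  interpret N: product_sigma_finite "\<lambda>i. density (M i) (g i)" by fact
  have meas: "(\<lambda>x. \<Prod>i\<in>I. g i (x i)) \<in> borel_measurable (PiM I M)"
  proof (rule borel_measurable_prod_ennreal)
    fix i assume i: "i \<in> I"
    show "(\<lambda>x. g i (x i)) \<in> borel_measurable (PiM I M)"
      by (rule measurable_compose[OF measurable_component_singleton[OF i, of M] g[OF i]])
  qed
  show ?thesis
  proof (rule N.PiM_eqI[symmetric])
    show "sets (density (PiM I M) (\<lambda>x. \<Prod>i\<in>I. g i (x i))) = sets (PiM I (\<lambda>i. density (M i) (g i)))"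
      by (simp cong: sets_PiM_cong)
  next
    fix A assume "\<And>i. i \<in> I \<Longrightarrow> A i \<in> sets (density (M i) (g i))"
    then have A: "\<And>i. i \<in> I \<Longrightarrow> A i \<in> sets (M i)"
      by simp
    have "emeasure (density (PiM I M) (\<lambda>x. \<Prod>i\<in>I. g i (x i))) (Pi\<^sub>E I A) =
        (\<integral>\<^sup>+x. (\<Prod>i\<in>I. g i (x i)) * indicator (Pi\<^sub>E I A) x \<partial>PiM I M)"
      using A \<open>finite I\<close> by (intro emeasure_density meas sets_PiM_I_finite)
    also have "\<dots> = (\<integral>\<^sup>+x. (\<Prod>i\<in>I. g i (x i) * indicator (A i) (x i)) \<partial>PiM I M)"
    proof (rule nn_integral_cong)
      fix x assume "x \<in> space (PiM I M)"
      then have "indicator (Pi\<^sub>E I A) x = (\<Prod>i\<in>I. indicator (A i) (x i) :: ennreal)"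
        using \<open>finite I\<close> by (auto simp: indicator_def space_PiM PiE_iff prod_eq_1_iff)
      then show "(\<Prod>i\<in>I. g i (x i)) * indicator (Pi\<^sub>E I A) x =
          (\<Prod>i\<in>I. g i (x i) * indicator (A i) (x i))"
        by (simp add: prod.distrib)
    qed
    also have "\<dots> = (\<Prod>i\<in>I. \<integral>\<^sup>+x. g i x * indicator (A i) x \<partial>M i)"
      using g A \<open>finite I\<close> by (intro M.product_nn_integral_prod) auto
    also have "\<dots> = (\<Prod>i\<in>I. emeasure (density (M i) (g i)) (A i))"
      using g A by (intro prod.cong) (simp_all add: emeasure_density)
    finally show "emeasure (density (PiM I M) (\<lambda>x. \<Prod>i\<in>I. g i (x i))) (Pi\<^sub>E I A) =
        (\<Prod>i\<in>I. emeasure (density (M i) (g i)) (A i))" .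
  qed fact
qed

text \<open>This is Cauchy--Schwarz for \<open>g\<close> and \<open>indicator A\<close>, the
  indicator being its own square. It transfers a small probability under \<open>M\<close> to the
  measure with density \<open>g\<close>.\<close>

lemma emeasure_density_power2_le:
  assumes g [measurable]: "g \<in> borel_measurable M" and A [measurable]: "A \<in> sets M"
  shows "(emeasure (density M g) A)\<^sup>2 \<le> (\<integral>\<^sup>+x. (g x)\<^sup>2 \<partial>M) * emeasure M A"
proof -
  have "(\<integral>\<^sup>+x. (indicator A x :: ennreal)\<^sup>2 \<partial>M) = (\<integral>\<^sup>+x. indicator A x \<partial>M)"
    by (intro nn_integral_cong) (simp add: indicator_def)
  then show ?thesis
    using Cauchy_Schwarz_nn_integral[of g M "indicator A"] by (simp add: emeasure_density)
qed

section \<open>Likelihood ratios of normal laws and their second moments\<close>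

abbreviation normal_law :: "real \<Rightarrow> real \<Rightarrow> real measure" where
  "normal_law \<mu> \<sigma> \<equiv> density lborel (\<lambda>x. ennreal (normal_density \<mu> \<sigma> x))"

text \<open>The numerator \<open>2 * \<mu> * x - \<mu>\<^sup>2\<close> equals
  \<open>x\<^sup>2 - (x - \<mu>)\<^sup>2\<close>, so the exponential is the quotient of the two
  normal densities.\<close>

lemma normal_law_eq_density:
  assumes "\<sigma> > 0"
  shows "normal_law \<mu> \<sigma> = density (normal_law 0 \<sigma>) (\<lambda>x. ennreal (exp ((2 * \<mu> * x - \<mu>\<^sup>2) / (2 * \<sigma>\<^sup>2))))"
proof -
  have "normal_density \<mu> \<sigma> x = normal_density 0 \<sigma> x * exp ((2 * \<mu> * x - \<mu>\<^sup>2) / (2 * \<sigma>\<^sup>2))" for x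
    using assms
    by (simp add: normal_density_def exp_add[symmetric] field_simps power2_eq_square)
  then show ?thesis
    by (subst density_density_eq) (auto simp: ennreal_mult'[symmetric] intro!: density_cong)
qed

text \<open>Completing the square turns the centred density times the squared ratio into a constant
  multiple of the normal density with mean \<open>2 * \<mu>\<close>, which integrates to 1.\<close>

lemma nn_integral_normal_likelihood_power2:
  assumes "\<sigma> > 0"
  shows "(\<integral>\<^sup>+x. (ennreal (exp ((2 * \<mu> * x - \<mu>\<^sup>2) / (2 * \<sigma>\<^sup>2))))\<^sup>2 \<partial>normal_law 0 \<sigma>) =
    ennreal (exp (\<mu>\<^sup>2 / \<sigma>\<^sup>2))"
proof -
  have *: "normal_density 0 \<sigma> x * (exp ((2 * \<mu> * x - \<mu>\<^sup>2) / (2 * \<sigma>\<^sup>2)))\<^sup>2 =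
      exp (\<mu>\<^sup>2 / \<sigma>\<^sup>2) * normal_density (2 * \<mu>) \<sigma> x" for x
    using assms
    by (simp add: normal_density_def exp_add[symmetric] exp_double[symmetric] field_simps power2_eq_square)
  have "(\<integral>\<^sup>+x. (ennreal (exp ((2 * \<mu> * x - \<mu>\<^sup>2) / (2 * \<sigma>\<^sup>2))))\<^sup>2 \<partial>normal_law 0 \<sigma>) =
      (\<integral>\<^sup>+x. ennreal (exp (\<mu>\<^sup>2 / \<sigma>\<^sup>2)) * ennreal (normal_density (2 * \<mu>) \<sigma> x) \<partial>lborel)"
    by (subst nn_integral_density)
      (auto simp: ennreal_power ennreal_mult'[symmetric] * intro!: nn_integral_cong)
  also have "\<dots> = ennreal (exp (\<mu>\<^sup>2 / \<sigma>\<^sup>2)) * emeasure (normal_law (2 * \<mu>) \<sigma>) (space (normal_law (2 * \<mu>) \<sigma>))"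
    by (simp add: nn_integral_cmult emeasure_density)
  also have "\<dots> = ennreal (exp (\<mu>\<^sup>2 / \<sigma>\<^sup>2))"
    using prob_space.emeasure_space_1[OF prob_space_normal_density[OF assms]] by simp
  finally show ?thesis .
qed

text \<open>The likelihood ratio is a product over coordinates, so its second moment under the
  product law is the product of the one-dimensional second moments.\<close>

lemma emeasure_PiM_normal_law_power2_le:
  assumes "\<sigma> > 0" and "finite I" and A: "A \<in> sets (PiM I (\<lambda>_. borel))"
  shows "(emeasure (PiM I (\<lambda>i. normal_law (f i) \<sigma>)) A)\<^sup>2 \<le>
    ennreal (exp (\<Sum>i\<in>I. (f i)\<^sup>2 / \<sigma>\<^sup>2)) * emeasure (PiM I (\<lambda>_. normal_law 0 \<sigma>)) A"
proof -
  let ?g = "\<lambda>i x. ennreal (exp ((2 * f i * x - (f i)\<^sup>2) / (2 * \<sigma>\<^sup>2)))"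
  let ?Q = "PiM I (\<lambda>_. normal_law 0 \<sigma>)"
  have laws: "product_sigma_finite (\<lambda>i. normal_law (h i) \<sigma>)" for h :: "'a \<Rightarrow> real"
    using prob_space_normal_density[OF \<open>\<sigma> > 0\<close>]
    by (auto simp: product_sigma_finite_def intro: prob_space_imp_sigma_finite)
  interpret product_sigma_finite "\<lambda>_::'a. normal_law 0 \<sigma>"
    by (rule laws)
  have law: "normal_law (f i) \<sigma> = density (normal_law 0 \<sigma>) (?g i)" for i
    using \<open>\<sigma> > 0\<close> by (rule normal_law_eq_density)
  have "PiM I (\<lambda>i. normal_law (f i) \<sigma>) = density ?Q (\<lambda>x. \<Prod>i\<in>I. ?g i (x i))"
    unfolding law
    using laws[where h = f] \<open>finite I\<close>
    by (intro PiM_density laws) (simp_all add: law)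
  moreover have "A \<in> sets ?Q"
    using A sets_PiM_cong[of I I "\<lambda>_. normal_law 0 \<sigma>" "\<lambda>_. borel"] by simp
  moreover have "(\<lambda>x. \<Prod>i\<in>I. ?g i (x i)) \<in> borel_measurable ?Q"
    by (intro borel_measurable_prod_ennreal measurable_compose[OF measurable_component_singleton]) auto
  ultimately have "(emeasure (PiM I (\<lambda>i. normal_law (f i) \<sigma>)) A)\<^sup>2 \<le>
      (\<integral>\<^sup>+x. (\<Prod>i\<in>I. ?g i (x i))\<^sup>2 \<partial>?Q) * emeasure ?Q A"
    by (simp only: emeasure_density_power2_le)
  also have "(\<integral>\<^sup>+x. (\<Prod>i\<in>I. ?g i (x i))\<^sup>2 \<partial>?Q) =
      (\<integral>\<^sup>+x. (\<Prod>i\<in>I. (?g i (x i))\<^sup>2) \<partial>?Q)"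
    by (simp only: prod_power_distrib)
  also have "\<dots> = (\<Prod>i\<in>I. \<integral>\<^sup>+x. (?g i x)\<^sup>2 \<partial>normal_law 0 \<sigma>)"
    using \<open>finite I\<close> by (intro product_nn_integral_prod) auto
  also have "\<dots> = (\<Prod>i\<in>I. ennreal (exp ((f i)\<^sup>2 / \<sigma>\<^sup>2)))"
    using \<open>\<sigma> > 0\<close> by (simp only: nn_integral_normal_likelihood_power2)
  also have "\<dots> = ennreal (exp (\<Sum>i\<in>I. (f i)\<^sup>2 / \<sigma>\<^sup>2))"
    using \<open>finite I\<close> by (simp add: prod_ennreal exp_sum)
  finally show ?thesis .
qed

section \<open>Gaussian sequences and the natural filtration\<close>

text \<open>\<open>gaussian_laws\<close> describes laws by their properties; the infinite product is
  a concrete member on which probabilities can be computed.\<close>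

definition normal_seq :: "(nat \<Rightarrow> real) \<Rightarrow> real \<Rightarrow> (nat \<Rightarrow> real) measure" where
  "normal_seq f \<sigma> = PiM {1..} (\<lambda>i. normal_law (f i) \<sigma>)"

lemma sets_normal_seq [simp, measurable_cong]: "sets (normal_seq f \<sigma>) = sets seq_space"
  unfolding normal_seq_def seq_space_def by (intro sets_PiM_cong) simp_all

lemma space_normal_seq [simp]: "space (normal_seq f \<sigma>) = space seq_space"
  by (rule sets_eq_imp_space_eq) simp

lemma normal_seq_in_gaussian_laws:
  assumes "\<sigma> > 0"
  shows "normal_seq f \<sigma> \<in> gaussian_laws f \<sigma>"
proof -
  have prob: "prob_space (normal_law (f i) \<sigma>)" for i
    using assms by (rule prob_space_normal_density)
  interpret prob_space "normal_seq f \<sigma>"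
    unfolding normal_seq_def by (intro prob_space_PiM prob)
  have rv: "(\<lambda>\<omega>. \<omega> i) \<in> borel_measurable (normal_seq f \<sigma>)" if "i \<ge> 1" for i
    using that measurable_component_singleton[of i "{1..}" "\<lambda>_. borel"]
    by (simp add: measurable_cong_sets[OF sets_normal_seq refl] seq_space_def)
  have distr: "distr (normal_seq f \<sigma>) borel (\<lambda>\<omega>. \<omega> i) = normal_law (f i) \<sigma>" if "i \<ge> 1" for i
  proof -
    have "distr (normal_seq f \<sigma>) borel (\<lambda>\<omega>. \<omega> i) =
        distr (normal_seq f \<sigma>) (normal_law (f i) \<sigma>) (\<lambda>\<omega>. \<omega> i)"
      by (intro distr_cong) auto
    also have "\<dots> = normal_law (f i) \<sigma>"
      unfolding normal_seq_def using that prob by (intro distr_PiM_component) auto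
    finally show ?thesis .
  qed
  have "indep_vars (\<lambda>_. borel) (\<lambda>i \<omega>. \<omega> i) {1..}"
  proof (subst indep_vars_iff_distr_eq_PiM')
    \<comment> \<open>Points of \<open>seq_space\<close> are extensional on \<open>{1..}\<close>, so
      the restriction is the identity there. The joint law is thus the product of its marginals,
      which is independence.\<close>
    have "distr (normal_seq f \<sigma>) (\<Pi>\<^sub>M i\<in>{1..}. borel) (\<lambda>\<omega>. restrict \<omega> {1..}) =
        distr (normal_seq f \<sigma>) (normal_seq f \<sigma>) (\<lambda>\<omega>. \<omega>)"
      by (intro distr_cong)
        (simp_all add: seq_space_def space_PiM PiE_def extensional_restrict)
    also have "\<dots> = normal_seq f \<sigma>"
      by (rule distr_id)
    also have "\<dots> = (\<Pi>\<^sub>M i\<in>{1..}. distr (normal_seq f \<sigma>) borel (\<lambda>\<omega>. \<omega> i))"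
      by (subst (1) normal_seq_def, rule PiM_cong) (simp_all add: distr)
    finally show "distr (normal_seq f \<sigma>) (\<Pi>\<^sub>M i\<in>{1..}. borel) (\<lambda>\<omega>. \<lambda>i\<in>{1..}. \<omega> i) =
        (\<Pi>\<^sub>M i\<in>{1..}. distr (normal_seq f \<sigma>) borel (\<lambda>\<omega>. \<omega> i))" .
  qed (use rv in auto)
  moreover have "distributed (normal_seq f \<sigma>) lborel (\<lambda>\<omega>. \<omega> i) (normal_density (f i) \<sigma>)"
    if "i \<ge> 1" for i
  proof -
    have "distr (normal_seq f \<sigma>) lborel (\<lambda>\<omega>. \<omega> i) = distr (normal_seq f \<sigma>) borel (\<lambda>\<omega>. \<omega> i)"
      by (intro distr_cong) auto
    then show ?thesis
      using that rv distr by (simp add: distributed_def)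
  qed
  ultimately show ?thesis
    by (simp add: gaussian_laws_def prob_space_axioms)
qed

text \<open>The generators of the filtration at time \<open>N\<close> are preimages under
  restriction to the first \<open>N\<close> coordinates, and such preimages form a
  \<sigma>-algebra.\<close>

lemma natural_filtration_cylinder:
  assumes "A \<in> sets (natural_filtration (enat N))"
  obtains B where "B \<in> sets (PiM {1..N} (\<lambda>_. borel))"
    and "A = (\<lambda>\<omega>. restrict \<omega> {1..N}) -` B \<inter> space seq_space"
proof -
  let ?r = "\<lambda>\<omega>. restrict \<omega> {1..N} :: nat \<Rightarrow> real"
  let ?V = "vimage_algebra (space seq_space) ?r (PiM {1..N} (\<lambda>_. borel))"
  have r: "?r \<in> space seq_space \<rightarrow> space (PiM {1..N} (\<lambda>_. borel))"
    by (auto simp: space_PiM)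
  have "sets (natural_filtration (enat N)) \<subseteq> sets ?V"
    unfolding natural_filtration_def
  proof (subst sets_measure_of)
    show "sigma_sets (space seq_space)
        {{\<omega> \<in> space seq_space. \<omega> i \<in> A} |i A. 1 \<le> i \<and> enat i \<le> enat N \<and> A \<in> sets borel} \<subseteq> sets ?V"
    proof (rule sets.sigma_sets_subset', safe)
      fix i :: nat and A :: "real set" assume "1 \<le> i" "enat i \<le> enat N" and [measurable]: "A \<in> sets borel"
      then have i: "i \<in> {1..N}"
        by simp
      then have "{x \<in> space (PiM {1..N} (\<lambda>_. borel)). x i \<in> A} \<in> sets (PiM {1..N} (\<lambda>_. borel))"
        by measurable
      then have "?r -` {x \<in> space (PiM {1..N} (\<lambda>_. borel)). x i \<in> A} \<inter> space seq_space \<in> sets ?V"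
        by (rule in_vimage_algebra)
      also have "?r -` {x \<in> space (PiM {1..N} (\<lambda>_. borel)). x i \<in> A} \<inter> space seq_space =
          {\<omega> \<in> space seq_space. \<omega> i \<in> A}"
        using i by (auto simp: space_PiM)
      finally show "{\<omega> \<in> space seq_space. \<omega> i \<in> A} \<in> sets ?V" .
    qed (rule sets_vimage_algebra_space)
  qed auto
  with assms have "A \<in> sets ?V"
    by auto
  then show ?thesis
    using that unfolding sets_vimage_algebra2[OF r] by blast
qed

lemma sets_natural_filtration_subset: "sets (natural_filtration t) \<subseteq> sets seq_space"
  unfolding natural_filtration_def
proof (subst sets_measure_of)
  show "sigma_sets (space seq_space)
      {{\<omega> \<in> space seq_space. \<omega> i \<in> A} |i A. 1 \<le> i \<and> enat i \<le> t \<and> A \<in> sets borel} \<subseteq> sets seq_space"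
  proof (rule sets.sigma_sets_subset, safe)
    fix i :: nat and A :: "real set" assume "1 \<le> i" and [measurable]: "A \<in> sets borel"
    then have "i \<in> {1..}"
      by simp
    then show "{\<omega> \<in> space seq_space. \<omega> i \<in> A} \<in> sets seq_space"
      unfolding seq_space_def by measurable
  qed
qed auto

lemma space_natural_filtration [simp]: "space (natural_filtration t) = space seq_space"
  unfolding natural_filtration_def by (rule space_measure_of) auto

text \<open>Events known by the finite time \<open>N\<close> depend only on the first
  \<open>N\<close> observations, whose law is a finite product, so the finite-dimensional bound
  applies.\<close>

lemma emeasure_normal_seq_power2_le:
  assumes "\<sigma> > 0" and A: "A \<in> sets (natural_filtration (enat N))"
  shows "(emeasure (normal_seq f \<sigma>) A)\<^sup>2 \<le>
    ennreal (exp (\<Sum>i=1..N. (f i)\<^sup>2 / \<sigma>\<^sup>2)) * emeasure (normal_seq (\<lambda>_. 0) \<sigma>) A"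
proof -
  obtain B where B: "B \<in> sets (PiM {1..N} (\<lambda>_. borel))"
    and A_eq: "A = (\<lambda>\<omega>. restrict \<omega> {1..N}) -` B \<inter> space seq_space"
    using natural_filtration_cylinder[OF A] .
  have "emeasure (normal_seq h \<sigma>) A = emeasure (PiM {1..N} (\<lambda>i. normal_law (h i) \<sigma>)) B" for h
  proof -
    interpret product_prob_space "\<lambda>i. normal_law (h i) \<sigma>" "{1..}"
      using prob_space_normal_density[OF \<open>\<sigma> > 0\<close>] by (intro product_prob_spaceI)
    have B': "B \<in> sets (PiM {1..N} (\<lambda>i. normal_law (h i) \<sigma>))"
      using B by (simp cong: sets_PiM_cong)
    have "emeasure (PiM {1..N} (\<lambda>i. normal_law (h i) \<sigma>)) B =
        emeasure (distr (normal_seq h \<sigma>) (PiM {1..N} (\<lambda>i. normal_law (h i) \<sigma>))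
          (\<lambda>\<omega>. restrict \<omega> {1..N})) B"
      unfolding normal_seq_def by (subst distr_PiM_restrict_finite) auto
    also have "\<dots> = emeasure (normal_seq h \<sigma>) A"
      using B' by (subst emeasure_distr)
        (auto simp: A_eq normal_seq_def intro!: measurable_restrict_subset simp flip: space_normal_seq[of h \<sigma>])
    finally show ?thesis ..
  qed
  then show ?thesis
    using emeasure_PiM_normal_law_power2_le[OF \<open>\<sigma> > 0\<close> _ B, where f = f] by simp
qed

section \<open>From false alarm control to the delay bound\<close>

lemma detection_prob_le:
  assumes "\<sigma> > 0" and T: "T \<in> detection_procedures \<sigma> \<alpha>"
  shows "(emeasure (normal_seq f \<sigma>) {\<omega> \<in> space seq_space. T \<omega> \<le> enat N})\<^sup>2 \<le>
    ennreal (exp (\<Sum>i=1..N. (f i)\<^sup>2 / \<sigma>\<^sup>2)) * ennreal \<alpha>"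
proof -
  let ?P = "normal_seq (\<lambda>_. 0) \<sigma>"
  have stop: "{\<omega> \<in> space seq_space. T \<omega> \<le> t} \<in> sets (natural_filtration t)" for t
    using T by (auto simp: detection_procedures_def stopping_time_def pred_def)
  have law: "?P \<in> gaussian_laws (\<lambda>_. 0) \<sigma>"
    using \<open>\<sigma> > 0\<close> by (rule normal_seq_in_gaussian_laws)
  then interpret prob_space ?P
    by (simp add: gaussian_laws_def)
  have "?P \<in> no_change_laws \<sigma>"
    using law by (auto simp: no_change_laws_def)
  then have alarm: "measure ?P {\<omega> \<in> space seq_space. T \<omega> < \<infinity>} \<le> \<alpha>"
    using T by (auto simp: detection_procedures_def)
  \<comment> \<open>Writing the event as a countable union over finite times gives its
    measurability, needed for monotonicity below.\<close>
  have "{\<omega> \<in> space seq_space. T \<omega> < \<infinity>} = (\<Union>n. {\<omega> \<in> space seq_space. T \<omega> \<le> enat n})"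
    by (auto dest: enat_ile)
  also have "\<dots> \<in> sets ?P"
    using stop sets_natural_filtration_subset by (intro sets.countable_UN) auto
  finally have "emeasure ?P {\<omega> \<in> space seq_space. T \<omega> \<le> enat N} \<le>
      emeasure ?P {\<omega> \<in> space seq_space. T \<omega> < \<infinity>}"
    by (intro emeasure_mono) (auto dest: enat_ile)
  also have "\<dots> \<le> ennreal \<alpha>"
    using alarm by (simp add: emeasure_eq_measure ennreal_leI)
  finally show ?thesis
    using emeasure_normal_seq_power2_le[OF \<open>\<sigma> > 0\<close> stop[of "enat N"], of f]
    by (meson mult_left_mono order_trans zero_le)
qed

theorem proposition7:
  fixes \<kappa> \<sigma> \<alpha> :: real and \<Delta> :: nat
  assumes "\<kappa> > 0" and "\<sigma> > 0" and "0 < \<alpha>" and "\<alpha> < 1"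
    and "\<sigma>\<^sup>2 / (4 * \<kappa>\<^sup>2) * ln (1 / \<alpha>) \<ge> 3"
    and "\<alpha> + 2 * \<alpha> powr (1 / 4) < 1 / 2"
    and "\<alpha> powr (5 / 4) * ln (1 / \<alpha>) \<le> 2 * \<kappa>\<^sup>2 / \<sigma>\<^sup>2"
    and "\<Delta> \<ge> 1"
  shows "(INF T \<in> detection_procedures \<sigma> \<alpha>. SUP P \<in> change_laws \<kappa> \<sigma> \<Delta>. expected_delay P \<Delta> T)
           \<ge> ennreal (\<sigma>\<^sup>2 / (4 * \<kappa>\<^sup>2) * ln (1 / \<alpha>))"
proof (rule INF_greatest)
  fix T assume T: "T \<in> detection_procedures \<sigma> \<alpha>"
  define L where "L = \<sigma>\<^sup>2 / (4 * \<kappa>\<^sup>2) * ln (1 / \<alpha>)"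
  \<comment> \<open>Twice the target delay \<open>L\<close>: the factor 2 will pay for missing the
    change only with probability 1/2.\<close>
  define n where "n = nat \<lfloor>2 * L\<rfloor>"
  \<comment> \<open>The mean before the change agrees with the reference law of mean 0, so only the
    \<open>n\<close> observations after \<Delta> contribute to the exponent.\<close>
  define f where "f i = (if i \<le> \<Delta> then 0 else \<kappa>)" for i
  define A where "A = {\<omega> \<in> space seq_space. T \<omega> \<le> enat (\<Delta> + n)}"
  let ?P = "normal_seq f \<sigma>"
  have "L \<ge> 3"
    using assms by (simp add: L_def)
  \<comment> \<open>Positivity of \<open>L\<close> ensures that \<open>nat\<close> does not truncate
    the floor.\<close>
  then have n: "real n \<le> 2 * L" "2 * L < real n + 1"
    unfolding n_def by linarith+
  have law: "?P \<in> gaussian_laws f \<sigma>"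
    using \<open>\<sigma> > 0\<close> by (rule normal_seq_in_gaussian_laws)
  then interpret prob_space ?P
    by (simp add: gaussian_laws_def)
  have A: "A \<in> events"
    using T sets_natural_filtration_subset[of "enat (\<Delta> + n)"]
    by (auto simp: A_def detection_procedures_def stopping_time_def pred_def)
  have "(\<Sum>i=1..\<Delta> + n. (f i)\<^sup>2 / \<sigma>\<^sup>2) = (\<Sum>i\<in>{\<Delta> + 1..\<Delta> + n}. \<kappa>\<^sup>2 / \<sigma>\<^sup>2)"
    by (intro sum.mono_neutral_cong_right) (auto simp: f_def)
  also have "\<dots> = real n * (\<kappa>\<^sup>2 / \<sigma>\<^sup>2)"
    by simp
  also have "\<dots> \<le> 2 * L * (\<kappa>\<^sup>2 / \<sigma>\<^sup>2)"
    using n by (intro mult_right_mono) auto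
  also have "\<dots> = ln (1 / \<alpha>) / 2"
    using \<open>\<kappa> > 0\<close> \<open>\<sigma> > 0\<close> by (simp add: L_def field_simps)
  also have "\<dots> = - (1 / 2) * ln \<alpha>"
    using \<open>0 < \<alpha>\<close> by (simp add: ln_div)
  finally have "exp (\<Sum>i=1..\<Delta> + n. (f i)\<^sup>2 / \<sigma>\<^sup>2) * \<alpha> \<le> exp (- (1 / 2) * ln \<alpha>) * exp (ln \<alpha>)"
    using \<open>0 < \<alpha>\<close> by simp
  also have "\<dots> = (\<alpha> powr (1 / 4))\<^sup>2"
    using \<open>0 < \<alpha>\<close>
    by (simp add: powr_def exp_add[symmetric] exp_double[symmetric] del: exp_ln)
  finally have "(emeasure ?P A)\<^sup>2 \<le> ennreal ((\<alpha> powr (1 / 4))\<^sup>2)"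
    using detection_prob_le[OF \<open>\<sigma> > 0\<close> T, of f "\<Delta> + n"] \<open>0 < \<alpha>\<close>
    by (simp add: A_def ennreal_mult'[symmetric] order.trans[OF _ ennreal_leI])
  then have "(prob A)\<^sup>2 \<le> (\<alpha> powr (1 / 4))\<^sup>2"
    by (simp add: emeasure_eq_measure ennreal_power)
  then have "prob A \<le> \<alpha> powr (1 / 4)"
    by (rule power2_le_imp_le) simp
  \<comment> \<open>The assumption \<open>\<alpha> + 2 * \<alpha> powr (1 / 4) < 1 / 2\<close> with
    \<open>\<alpha> > 0\<close> gives \<open>\<alpha> powr (1 / 4) < 1 / 4\<close>.\<close>
  then have "prob (space ?P - A) \<ge> 1 / 2"
    using assms A by (simp add: prob_compl del: space_normal_seq)
  moreover have "2 * L * (1 / 2) \<le> (real n + 1) * prob (space ?P - A)"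
    using calculation n \<open>L \<ge> 3\<close> by (intro mult_mono) auto
  ultimately have "ennreal L \<le> ennreal ((real n + 1) * prob (space ?P - A))"
    by (intro ennreal_leI) simp
  also have "\<dots> = ennreal_of_enat (enat (n + 1)) * emeasure ?P (space ?P - A)"
    by (simp add: emeasure_eq_measure ennreal_mult' ennreal_of_nat_eq_real_of_nat add.commute)
  also have "\<dots> = (\<integral>\<^sup>+\<omega>. ennreal_of_enat (enat (n + 1)) * indicator (space ?P - A) \<omega> \<partial>?P)"
    using A by (intro nn_integral_cmult_indicator[symmetric]) auto
  also have "\<dots> \<le> expected_delay ?P \<Delta> T"
    unfolding expected_delay_def
  proof (rule nn_integral_mono)
    fix \<omega>
    \<comment> \<open>Integrality of time turns a strict excess over \<open>\<Delta> + n\<close>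
      into a delay of at least \<open>n + 1\<close>, which exceeds \<open>2 * L\<close>; for
      \<open>T \<omega> = \<infinity>\<close> the difference is infinite.\<close>
    have "enat (n + 1) \<le> T \<omega> - enat \<Delta>" if "\<not> T \<omega> \<le> enat (\<Delta> + n)"
      using that by (cases "T \<omega>") auto
    then show "ennreal_of_enat (enat (n + 1)) * indicator (space ?P - A) \<omega> \<le>
        ennreal_of_enat (T \<omega> - enat \<Delta>)"
      by (auto simp: A_def indicator_def simp del: ennreal_of_enat_enat)
  qed
  also have "\<dots> \<le> (SUP P \<in> change_laws \<kappa> \<sigma> \<Delta>. expected_delay P \<Delta> T)"
  proof (rule SUP_upper)
    show "?P \<in> change_laws \<kappa> \<sigma> \<Delta>"
      using law \<open>\<kappa> > 0\<close> unfolding change_laws_def by (intro UN_I[of f]) (auto simp: f_def)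
  qed
  finally show "ennreal (\<sigma>\<^sup>2 / (4 * \<kappa>\<^sup>2) * ln (1 / \<alpha>)) \<le>
      (SUP P \<in> change_laws \<kappa> \<sigma> \<Delta>. expected_delay P \<Delta> T)"
    by (simp add: L_def)
qed

end
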